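(* Let $C \subset \mathbb{R}^n$, let $I$ be a nonempty subset of $\{1, \ldots, n\}$, and assume that $\pi(C)$ is unbounded, where $\pi(x) = (x_i)_{i \in I}$. Then the Clarke tangent cone at infinity $T_C(\infty_I)$ is a closed convex cone in $\mathbb{R}^n$ containing the origin.
   Context: $\mathbb{R}^n$ carries the Euclidean norm $\|\cdot\|$. For a nonempty index set $I \subset \{1,\ldots,n\}$, $\pi \colon \mathbb{R}^n \to \mathbb{R}^{\#I}$ is the projection $x = (x_1,\ldots,x_n) \mapsto (x_i)_{i\in I}$; $\pi(x_k) \to \infty$ means $\|\pi(x_k)\| \to \infty$. The notation $t_k \searrow 0$ means $t_k > 0$ and $t_k$ decreases to $0$. The Clarke tangent cone of $C$ at infinity (with respect to $I$), $T_C(\infty_I)$, is the set of all $v \in \mathbb{R}^n$ such that, for all sequences $x_k \in C$ with $\pi(x_k) \to \infty$ and $t_k \searrow 0$, there exists a sequence $v_k \to v$ with $x_k + t_k v_k \in C$ for all $k$. *)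

theory Defs
  imports "HOL-Analysis.Analysis"
begin

text \<open>
  The target \<open>\<real>\<^bsup>#I\<^esup>\<close> of the projection is realised as the coordinate subspace of
  vectors vanishing outside \<open>I\<close>, so that the projection has a target type for every \<open>I\<close>.
  The first two lemmas below say that this changes nothing: two points have the same image iff
  their coordinates in \<open>I\<close> agree, and the norm is the Euclidean norm of those coordinates.
\<close>

definition coord_proj :: "'n::finite set \<Rightarrow> real ^ 'n \<Rightarrow> real ^ 'n" where
  "coord_proj I x = (\<chi> i. if i \<in> I then x $ i else 0)"

lemma coord_proj_eq_iff: "coord_proj I x = coord_proj I y \<longleftrightarrow> (\<forall>i\<in>I. x $ i = y $ i)"
  by (auto simp: coord_proj_def vec_eq_iff)

lemma norm_coord_proj: "norm (coord_proj I x) = L2_set (\<lambda>i. x $ i) I"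
  unfolding norm_vec_def L2_set_def coord_proj_def
  by (auto simp: if_distrib if_distribR sum.If_cases cong: if_cong)

lemma linear_coord_proj: "linear (coord_proj I)"
  by (rule linearI) (auto simp: coord_proj_def vec_eq_iff)

text \<open>Monotone decrease is not required to be strict.\<close>

definition decreases_to_zero :: "(nat \<Rightarrow> real) \<Rightarrow> bool" where
  "decreases_to_zero t \<longleftrightarrow> (\<forall>k. t k > 0) \<and> decseq t \<and> t \<longlonglongrightarrow> 0"

definition clarke_tangent_cone_infinity ::
    "'n::finite set \<Rightarrow> (real ^ 'n) set \<Rightarrow> (real ^ 'n) set" where
  "clarke_tangent_cone_infinity I C =
    {v. \<forall>x t. (\<forall>k. x k \<in> C) \<longrightarrow>
           filterlim (\<lambda>k. norm (coord_proj I (x k))) at_top sequentially \<longrightarrow>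
           decreases_to_zero t \<longrightarrow>
           (\<exists>w. w \<longlonglongrightarrow> v \<and> (\<forall>k. x k + t k *\<^sub>R w k \<in> C))}"

end

(* A perturbation x + t w of a sequence x with t going to 0 and w convergent still has unbounded
   I-coordinates, so after moving along the first of two tangent vectors one may move along the
   second: the cone is closed under addition. Closedness holds because a sequence w k in
   S k = {w. x k + t k *\<^sub>R w \<in> C} converging to v exists iff the distance from v to S k tends to 0,
   and this distance is 1-Lipschitz in v. *)

theory Submission
  imports Defs
begin

text \<open>Any selection bounds the infimum distance by \<open>dist v (w k)\<close>. Conversely,
  since the infimum need not be attained, points of \<open>S k\<close> within \<open>1/(k+1)\<close>
  of it are chosen, and this error vanishes in the limit.\<close>

lemma exists_selection_tendsto_iff_infdist:
  fixes S :: "nat \<Rightarrow> 'a::metric_space set"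
  assumes ne: "\<And>k. S k \<noteq> {}"
  shows "(\<exists>w. w \<longlonglongrightarrow> v \<and> (\<forall>k. w k \<in> S k)) \<longleftrightarrow> (\<lambda>k. infdist v (S k)) \<longlonglongrightarrow> 0"
proof
  assume "\<exists>w. w \<longlonglongrightarrow> v \<and> (\<forall>k. w k \<in> S k)"
  then obtain w where w: "w \<longlonglongrightarrow> v" "\<And>k. w k \<in> S k"
    by blast
  have "(\<lambda>k. dist v (w k)) \<longlonglongrightarrow> 0"
    using tendsto_dist[OF tendsto_const w(1), of v] by simp
  then show "(\<lambda>k. infdist v (S k)) \<longlonglongrightarrow> 0"
    by (rule Lim_null_comparison[rotated])
       (use w(2) in \<open>simp add: infdist_nonneg infdist_le\<close>)
next
  assume lim: "(\<lambda>k. infdist v (S k)) \<longlonglongrightarrow> 0"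
  have "\<exists>w\<in>S k. dist v w < infdist v (S k) + inverse (real (Suc k))" for k
  proof (rule ccontr)
    assume "\<not> ?thesis"
    \<comment> \<open>If no such point exists, the left side is a lower bound for all distances from
      \<open>v\<close> to \<open>S k\<close>, hence at most their infimum. Nonemptiness ensures that
      \<open>infdist\<close> is this infimum and not its default value 0.\<close>
    then have "infdist v (S k) + inverse (real (Suc k)) \<le> infdist v (S k)"
      using ne[of k] by (subst (2) infdist_def) (auto intro!: cINF_greatest simp: not_less)
    then show False
      using positive_imp_inverse_positive[of "real (Suc k)"] by simp
  qed
  then obtain w where w: "\<And>k. w k \<in> S k"
      "\<And>k. dist v (w k) < infdist v (S k) + inverse (real (Suc k))"
    by metis
  have "(\<lambda>k. infdist v (S k) + inverse (real (Suc k))) \<longlonglongrightarrow> 0"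
    using tendsto_add[OF lim LIMSEQ_inverse_real_of_nat] by simp
  then have "(\<lambda>k. dist (w k) v) \<longlonglongrightarrow> 0"
    by (rule Lim_null_comparison[rotated])
       (use w(2) in \<open>auto simp: dist_commute intro!: always_eventually less_imp_le\<close>)
  then show "\<exists>w. w \<longlonglongrightarrow> v \<and> (\<forall>k. w k \<in> S k)"
    using w(1) tendsto_dist_iff by blast
qed

text \<open>The distance criterion replaces a diagonal construction: a nearby limit \<open>u\<close>
  controls the distances from \<open>v\<close> up to \<open>dist v u\<close>, uniformly in
  \<open>k\<close>.\<close>

lemma closed_limits_of_selections:
  fixes S :: "nat \<Rightarrow> 'a::metric_space set"
  assumes ne: "\<And>k. S k \<noteq> {}"
  shows "closed {v. \<exists>w. w \<longlonglongrightarrow> v \<and> (\<forall>k. w k \<in> S k)}"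
proof -
  have "(\<lambda>k. infdist v (S k)) \<longlonglongrightarrow> 0"
    if v: "\<And>e. e > 0 \<Longrightarrow> \<exists>u. (\<lambda>k. infdist u (S k)) \<longlonglongrightarrow> 0 \<and> dist u v < e" for v
  proof (rule tendstoI)
    fix e :: real assume "e > 0"
    then obtain u where u: "(\<lambda>k. infdist u (S k)) \<longlonglongrightarrow> 0" "dist u v < e / 2"
      using v[of "e / 2"] by auto
    have "\<forall>\<^sub>F k in sequentially. infdist u (S k) < e / 2"
      using \<open>e > 0\<close> by (intro order_tendstoD(2)[OF u(1)]) simp
    then show "\<forall>\<^sub>F k in sequentially. dist (infdist v (S k)) 0 < e"
    proof eventually_elim
      case (elim k)
      have "infdist v (S k) \<le> infdist u (S k) + dist v u"
        by (rule infdist_triangle)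
      with elim u(2) show ?case
        by (simp add: infdist_nonneg dist_commute)
    qed
  qed
  then show ?thesis
    \<comment> \<open>The set becomes the \<open>v\<close> whose distances tend to 0. The claim
      above says exactly that it contains every point of its closure.\<close>
    unfolding exists_selection_tendsto_iff_infdist[OF ne]
    unfolding closure_subset_eq[symmetric] subset_iff closure_approachable by blast
qed

lemma clarke_tangent_cone_infinityI:
  assumes "\<And>x t. \<lbrakk>\<And>k. x k \<in> C; filterlim (\<lambda>k. norm (coord_proj I (x k))) at_top sequentially;
      decreases_to_zero t\<rbrakk> \<Longrightarrow> \<exists>w. w \<longlonglongrightarrow> v \<and> (\<forall>k. x k + t k *\<^sub>R w k \<in> C)"
  shows "v \<in> clarke_tangent_cone_infinity I C"
  using assms by (auto simp: clarke_tangent_cone_infinity_def)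

lemma clarke_tangent_cone_infinityE:
  assumes "v \<in> clarke_tangent_cone_infinity I C" "\<And>k. x k \<in> C"
    and "filterlim (\<lambda>k. norm (coord_proj I (x k))) at_top sequentially" "decreases_to_zero t"
  obtains w where "w \<longlonglongrightarrow> v" "\<And>k. x k + t k *\<^sub>R w k \<in> C"
  using assms unfolding clarke_tangent_cone_infinity_def by blast

lemma zero_mem_clarke_tangent_cone_infinity: "0 \<in> clarke_tangent_cone_infinity I C"
  by (rule clarke_tangent_cone_infinityI) (auto intro!: exI[of _ "\<lambda>_. 0"])

lemma closed_clarke_tangent_cone_infinity: "closed (clarke_tangent_cone_infinity I C)"
proof -
  have "closed {v. \<exists>w. w \<longlonglongrightarrow> v \<and> (\<forall>k. x k + t k *\<^sub>R w k \<in> C)}"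
    if "\<forall>k. x k \<in> C" for x and t :: "nat \<Rightarrow> real"
  proof -
    \<comment> \<open>The base points lie in \<open>C\<close>, so the zero direction is always
      admissible; this supplies the required nonemptiness.\<close>
    have "0 \<in> {w. x k + t k *\<^sub>R w \<in> C}" for k
      using that by simp
    then have "{w. x k + t k *\<^sub>R w \<in> C} \<noteq> {}" for k
      by blast
    from closed_limits_of_selections[of "\<lambda>k. {w. x k + t k *\<^sub>R w \<in> C}", OF this]
    show ?thesis
      by simp
  qed
  \<comment> \<open>The universal quantifier over sequences turns into an intersection of closed
    sets, one for each admissible pair \<open>(x, t)\<close>.\<close>
  moreover have "clarke_tangent_cone_infinity I C =
      (\<Inter>(x, t) \<in> {(x, t). (\<forall>k. x k \<in> C) \<and>
          filterlim (\<lambda>k. norm (coord_proj I (x k))) at_top sequentially \<and> decreases_to_zero t}.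
        {v. \<exists>w. w \<longlonglongrightarrow> v \<and> (\<forall>k. x k + t k *\<^sub>R w k \<in> C)})"
    unfolding clarke_tangent_cone_infinity_def by blast
  ultimately show ?thesis
    by (auto intro!: closed_INT)
qed

lemma decreases_to_zero_mult:
  assumes "decreases_to_zero t" "c > 0"
  shows "decreases_to_zero (\<lambda>k. c * t k)"
  using assms tendsto_mult_right_zero[of t sequentially c]
  by (auto simp: decreases_to_zero_def decseq_def)

text \<open>For \<open>c > 0\<close> the factor is moved into the step size: \<open>v\<close> is
  tested against the steps \<open>c * t k\<close>, and \<open>c *\<^sub>R w k\<close> serves for the
  steps \<open>t k\<close>. The case \<open>c = 0\<close> is separate because the rescaled steps
  must stay positive.\<close>

lemma scaleR_mem_clarke_tangent_cone_infinity:
  assumes v: "v \<in> clarke_tangent_cone_infinity I C" and "c \<ge> 0"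
  shows "c *\<^sub>R v \<in> clarke_tangent_cone_infinity I C"
proof (cases "c = 0")
  case True
  then show ?thesis
    by (simp add: zero_mem_clarke_tangent_cone_infinity)
next
  case False
  with \<open>c \<ge> 0\<close> have "c > 0"
    by simp
  show ?thesis
  proof (rule clarke_tangent_cone_infinityI)
    fix x t
    assume x: "\<And>k. x k \<in> C" "filterlim (\<lambda>k. norm (coord_proj I (x k))) at_top sequentially"
      and t: "decreases_to_zero t"
    obtain w where w: "w \<longlonglongrightarrow> v" "\<And>k. x k + (c * t k) *\<^sub>R w k \<in> C"
      using clarke_tangent_cone_infinityE[OF v x decreases_to_zero_mult[OF t \<open>c > 0\<close>]] by blast
    have "(\<lambda>k. c *\<^sub>R w k) \<longlonglongrightarrow> c *\<^sub>R v"
      by (intro tendsto_intros w(1))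
    then show "\<exists>w. w \<longlonglongrightarrow> c *\<^sub>R v \<and> (\<forall>k. x k + t k *\<^sub>R w k \<in> C)"
      using w(2) by (intro exI[of _ "\<lambda>k. c *\<^sub>R w k"]) (simp add: mult.commute)
  qed
qed

text \<open>The projection is linear and continuous, so the perturbation has a convergent image,
  which cannot offset divergence to infinity.\<close>

lemma filterlim_norm_coord_proj_add:
  assumes x: "filterlim (\<lambda>k. norm (coord_proj I (x k))) at_top F" and y: "(y \<longlongrightarrow> a) F"
  shows "filterlim (\<lambda>k. norm (coord_proj I (x k + y k))) at_top F"
proof -
  have "((\<lambda>k. coord_proj I (y k)) \<longlongrightarrow> coord_proj I a) F"
    using linear_coord_proj[of I] y
    unfolding linear_conv_bounded_linear by (rule bounded_linear.tendsto)
  with x have "filterlim (\<lambda>k. coord_proj I (y k) + coord_proj I (x k)) at_infinity F"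
    by (intro tendsto_add_filterlim_at_infinity) (simp_all add: filterlim_norm_at_top_imp_at_infinity)
  then show ?thesis
    by (intro filterlim_at_infinity_imp_norm_at_top)
       (simp add: linear_add[OF linear_coord_proj] add.commute)
qed

lemma add_mem_clarke_tangent_cone_infinity:
  assumes u: "u \<in> clarke_tangent_cone_infinity I C" and v: "v \<in> clarke_tangent_cone_infinity I C"
  shows "u + v \<in> clarke_tangent_cone_infinity I C"
proof (rule clarke_tangent_cone_infinityI)
  fix x t
  assume x: "\<And>k. x k \<in> C" "filterlim (\<lambda>k. norm (coord_proj I (x k))) at_top sequentially"
    and t: "decreases_to_zero t"
  obtain a where a: "a \<longlonglongrightarrow> u" "\<And>k. x k + t k *\<^sub>R a k \<in> C"
    using clarke_tangent_cone_infinityE[OF u x t] by blast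
  \<comment> \<open>The displacements converge, so the moved points still go to infinity in the
    \<open>I\<close>-coordinates and are valid base points for \<open>v\<close>.\<close>
  have "(\<lambda>k. t k *\<^sub>R a k) \<longlonglongrightarrow> 0 *\<^sub>R u"
    using t a(1) by (intro tendsto_scaleR) (simp_all add: decreases_to_zero_def)
  note moved = filterlim_norm_coord_proj_add[OF x(2) this]
  \<comment> \<open>Reusing the same step sizes \<open>t\<close> lets the two displacements combine
    into \<open>t k *\<^sub>R (a k + b k)\<close>.\<close>
  obtain b where b: "b \<longlonglongrightarrow> v" "\<And>k. x k + t k *\<^sub>R a k + t k *\<^sub>R b k \<in> C"
    using clarke_tangent_cone_infinityE[OF v a(2) moved t] by blast
  show "\<exists>w. w \<longlonglongrightarrow> u + v \<and> (\<forall>k. x k + t k *\<^sub>R w k \<in> C)"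
    using b(2) tendsto_add[OF a(1) b(1)]
    by (intro exI[of _ "\<lambda>k. a k + b k"]) (simp add: scaleR_add_right add.assoc)
qed

theorem corollary3p5:
  fixes C :: "(real ^ 'n) set" and I :: "'n set"
  assumes "I \<noteq> {}"
    and "\<not> bounded (coord_proj I ` C)"
  shows "closed (clarke_tangent_cone_infinity I C) \<and>
         convex (clarke_tangent_cone_infinity I C) \<and>
         cone (clarke_tangent_cone_infinity I C) \<and>
         0 \<in> clarke_tangent_cone_infinity I C"
proof (intro conjI)
  show "closed (clarke_tangent_cone_infinity I C)"
    by (rule closed_clarke_tangent_cone_infinity)
  show "convex (clarke_tangent_cone_infinity I C)"
    \<comment> \<open>A convex combination is a sum of two nonnegative multiples, so closure under
      both operations suffices.\<close>
    by (intro convexI add_mem_clarke_tangent_cone_infinity scaleR_mem_clarke_tangent_cone_infinity)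
  show "cone (clarke_tangent_cone_infinity I C)"
    by (simp add: cone_def scaleR_mem_clarke_tangent_cone_infinity)
  show "0 \<in> clarke_tangent_cone_infinity I C"
    by (rule zero_mem_clarke_tangent_cone_infinity)
qed

end
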